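(* Let $(s_n)_{n\ge 10}$ be any one of the four sequences $(\alpha_n)$, $(\beta_n)$, $(\gamma_n)$, $(\delta_n)$ defined in the context. Then $$\log\log s_n \sim n\log\log n \quad\text{as } n\to\infty,$$ where $\log$ denotes the logarithm to base $10$ (i.e. $\log\log s_n/(n\log\log n)\to 1$).
   Context: For a positive integer $a$ with decimal expansion $a=\sum_{i=0}^{k} c_i 10^i$, $c_i\in\{0,\dots,9\}$, $c_k\neq 0$, and an integer $b\ge 10$, let $a\_b:=\sum_{i=0}^{k} c_i b^i$ (the decimal digit string of $a$ interpreted in base $b$); this is again a positive integer. Define for $n\ge 10$: $\alpha_{10}=10$ and $\alpha_n = 10\_(11\_(12\_(\cdots\_((n-1)\_n)\cdots)))$ for $n\ge 11$; $\beta_{10}=10$ and $\beta_n = ((\cdots((10\_11)\_12)\cdots)\_(n-1))\_n$ for $n\ge 11$ (equivalently $\beta_{n}=\beta_{n-1}\_n$); $\gamma_{10}=10$ and $\gamma_n = n\_((n-1)\_(\cdots\_(12\_(11\_10))\cdots))$ for $n\ge 11$ (equivalently $\gamma_n=n\_\gamma_{n-1}$); $\delta_{10}=10$ and $\delta_n = ((\cdots((n\_(n-1))\_(n-2))\cdots)\_11)\_10$ for $n\ge 11$. *)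

theory Defs
  imports Complex_Main "HOL-Library.Log_Nat" "HOL-Library.Landau_Symbols"
begin

definition rebase :: "nat \<Rightarrow> nat \<Rightarrow> nat" where
  "rebase a b = (\<Sum>i<floorlog 10 a. (a div 10 ^ i mod 10) * b ^ i)"

text \<open>Any decimal expansion of \<open>a\<close> with nonzero leading digit yields this value.\<close>

lemma decimal_expansion_digit:
  fixes c :: "nat \<Rightarrow> nat"
  assumes "\<And>i. i \<le> k \<Longrightarrow> c i \<le> 9" and "j \<le> k"
  shows "(\<Sum>i\<le>k. c i * 10 ^ i) div 10 ^ j mod 10 = c j"
  using assms
proof (induction k arbitrary: c j)
  case 0
  then show ?case by simp
next
  case (Suc k)
  have split: "(\<Sum>i\<le>Suc k. c i * 10 ^ i) = c 0 + 10 * (\<Sum>i\<le>k. c (Suc i) * 10 ^ i)"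
    by (subst sum.atMost_Suc_shift) (simp add: sum_distrib_left mult_ac)
  have c0: "c 0 \<le> 9" using Suc.prems by simp
  show ?case
  proof (cases j)
    case 0
    then show ?thesis using c0 split by simp
  next
    case (Suc j')
    have "(\<Sum>i\<le>Suc k. c i * 10 ^ i) div 10 = (\<Sum>i\<le>k. c (Suc i) * 10 ^ i)"
      using c0 split by simp
    moreover have "(\<Sum>i\<le>k. c (Suc i) * 10 ^ i) div 10 ^ j' mod 10 = c (Suc j')"
      using Suc.IH[of "\<lambda>i. c (Suc i)" j'] Suc.prems Suc by simp
    ultimately show ?thesis
      using Suc by (simp add: div_mult2_eq)
  qed
qed

lemma decimal_expansion_less:
  fixes c :: "nat \<Rightarrow> nat"
  assumes "\<And>i. i \<le> k \<Longrightarrow> c i \<le> 9"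
  shows "(\<Sum>i\<le>k. c i * 10 ^ i) < 10 ^ Suc k"
  using assms
proof (induction k)
  case 0
  from 0[of 0] show ?case by simp
next
  case (Suc k)
  have "(\<Sum>i\<le>k. c i * 10 ^ i) < 10 ^ Suc k" using Suc by simp
  moreover have "c (Suc k) * 10 ^ Suc k \<le> 9 * 10 ^ Suc k"
    using Suc.prems[of "Suc k"] by (intro mult_right_mono) auto
  ultimately have "(\<Sum>i\<le>k. c i * 10 ^ i) + c (Suc k) * 10 ^ Suc k < 10 * 10 ^ Suc k"
    by linarith
  then show ?case by simp
qed

lemma rebase_decimal_expansion:
  fixes c :: "nat \<Rightarrow> nat"
  assumes a: "a = (\<Sum>i\<le>k. c i * 10 ^ i)"
    and c: "\<And>i. i \<le> k \<Longrightarrow> c i \<le> 9" and ck: "c k \<noteq> 0"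
  shows "rebase a b = (\<Sum>i\<le>k. c i * b ^ i)"
proof -
  have lo: "10 ^ k \<le> a"
  proof -
    have "10 ^ k \<le> c k * 10 ^ k" using ck by simp
    also have "\<dots> \<le> a" unfolding a by (rule member_le_sum) auto
    finally show ?thesis .
  qed
  have hi: "a < 10 ^ Suc k" unfolding a by (rule decimal_expansion_less) (rule c)
  have fl: "floorlog 10 a = Suc k"
    using lo hi floorlog_le_iff[of 10 a k] floorlog_le_iff[of 10 a "Suc k"] by simp
  show ?thesis
    unfolding rebase_def fl lessThan_Suc_atMost
    by (rule sum.cong) (auto simp: a decimal_expansion_digit c)
qed

definition alpha :: "nat \<Rightarrow> nat" where
  "alpha n = foldr rebase [10..<n] n"

definition beta :: "nat \<Rightarrow> nat" where
  "beta n = foldl rebase 10 [11..<Suc n]"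

definition gamma :: "nat \<Rightarrow> nat" where
  "gamma n = foldr rebase (rev [11..<Suc n]) 10"

definition delta :: "nat \<Rightarrow> nat" where
  "delta n = foldl rebase n (rev [10..<n])"

lemma sequences_at_10: "alpha 10 = 10" "beta 10 = 10" "gamma 10 = 10" "delta 10 = 10"
  by (simp_all add: alpha_def beta_def gamma_def delta_def)

lemma sequences_at_13:
  "alpha 13 = rebase 10 (rebase 11 (rebase 12 13))"
  "beta 13 = rebase (rebase (rebase 10 11) 12) 13"
  "gamma 13 = rebase 13 (rebase 12 (rebase 11 10))"
  "delta 13 = rebase (rebase (rebase 13 12) 11) 10"
  by (simp_all add: alpha_def beta_def gamma_def delta_def upt_rec)

lemma beta_rec: "n \<ge> 11 \<Longrightarrow> beta n = rebase (beta (n - 1)) n"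
  by (cases n) (simp_all add: beta_def)

lemma gamma_rec: "n \<ge> 11 \<Longrightarrow> gamma n = rebase n (gamma (n - 1))"
  by (cases n) (simp_all add: gamma_def)

end

theory Submission
  imports Defs "HOL-Real_Asymp.Real_Asymp"
begin

text \<open>
  Rebasing is almost multiplicative on the number of digits: \<open>10 ^ p \<le> a\<close> and \<open>10 ^ q \<le> b\<close> give
  \<open>10 ^ (p * q) \<le> rebase a b\<close>, and for \<open>b \<ge> 10\<close> also \<open>a < 10 ^ p\<close> and \<open>b < 10 ^ q\<close> give
  \<open>rebase a b < 10 ^ (p * q)\<close>. Each of the four sequences combines every number from \<open>10\<close> to \<open>n\<close>
  exactly once, so however the brackets are placed, with \<open>k m = \<lfloor>log 10 m\<rfloor>\<close>,
  \[ \prod_{m=10}^n k(m) \le \log s_n \le \prod_{m=10}^n (k(m) + 1). \]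
  The logarithms of both products are asymptotic to \<open>n log log n\<close>; for the lower one, the factors
  with \<open>m \<ge> sqrt n\<close> suffice.
\<close>

subsection \<open>Size of a rebased number\<close>

text \<open>The leading digit alone suffices: it is nonzero and sits at a position
  \<open>k \<ge> p\<close>, so it contributes at least \<open>b ^ k \<ge> b ^ p\<close>.\<close>

lemma le_rebase:
  assumes "10 ^ p \<le> a" "10 ^ q \<le> b"
  shows "10 ^ (p * q) \<le> rebase a b"
proof -
  define k where "k = floorlog 10 a - 1"
  have "a > 0" using assms(1) by (metis gr0I le_zero_eq power_not_zero zero_neq_numeral)
  have "b > 0" using assms(2) by (metis gr0I le_zero_eq power_not_zero zero_neq_numeral)
  have fl: "floorlog 10 a = Suc k"
    using \<open>a > 0\<close> by (simp add: k_def floorlog_def)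
  have lo: "10 ^ k \<le> a" and hi: "a < 10 ^ Suc k"
    using floorlog_bounds[of a 10] \<open>a > 0\<close> by (auto simp: fl)
  have "(10::nat) ^ p < 10 ^ Suc k" using assms(1) hi by linarith
  then have "p \<le> k" by (subst (asm) power_strict_increasing_iff) auto
  have "a div 10 ^ k < 10" using hi by (simp add: less_mult_imp_div_less mult.commute)
  moreover have "a div 10 ^ k > 0" using lo by (simp add: div_greater_zero_iff)
  ultimately have lead: "a div 10 ^ k mod 10 \<ge> 1" by simp
  have "(10::nat) ^ (p * q) = (10 ^ q) ^ p" by (simp add: power_mult mult.commute[of p])
  also have "\<dots> \<le> b ^ p" using assms(2) by (simp add: power_mono)
  also have "\<dots> \<le> b ^ k" using \<open>p \<le> k\<close> \<open>b > 0\<close> by (simp add: power_increasing)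
  also have "\<dots> \<le> (a div 10 ^ k mod 10) * b ^ k" using lead by simp
  also have "\<dots> \<le> rebase a b"
    unfolding rebase_def fl by (rule member_le_sum) auto
  finally show ?thesis .
qed

lemma digit_sum_less:
  fixes b :: nat
  assumes "\<And>i. c i < b"
  shows "(\<Sum>i<k. c i * b ^ i) < b ^ k"
proof (induction k)
  case (Suc k)
  have "Suc (c k) * b ^ k \<le> b * b ^ k"
    using assms[of k] by (intro mult_right_mono) auto
  with Suc show ?case by simp
qed simp

text \<open>As \<open>b \<ge> 10\<close>, decimal digits are also valid base-\<open>b\<close>
  digits, so \<open>rebase a b\<close> has no more digits in base \<open>b\<close> than
  \<open>a\<close> has in base 10.\<close>

lemma rebase_less:
  assumes "10 \<le> b" "a < 10 ^ p" "b < 10 ^ q"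
  shows "rebase a b < 10 ^ (p * q)"
proof -
  have "floorlog 10 a \<le> p" using assms(2) by (simp add: floorlog_le_iff)
  show ?thesis
  \<comment> \<open>Strict monotonicity of powers fails for exponent 0; there \<open>a = 0\<close>
    and the digit sum is empty.\<close>
  proof (cases "p = 0")
    case True
    then show ?thesis using \<open>floorlog 10 a \<le> p\<close> by (simp add: rebase_def)
  next
    case False
    have "a div 10 ^ i mod 10 < b" for i
      using assms(1) by (meson less_le_trans mod_less_divisor zero_less_numeral)
    then have "rebase a b < b ^ floorlog 10 a"
      unfolding rebase_def by (intro digit_sum_less)
    also have "\<dots> \<le> b ^ p"
      using \<open>floorlog 10 a \<le> p\<close> assms(1) by (simp add: power_increasing)
    also have "\<dots> < (10 ^ q) ^ p"
      using assms(3) False by (intro power_strict_mono) auto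
    also have "\<dots> = 10 ^ (p * q)" by (simp add: power_mult mult.commute[of p])
    finally show ?thesis .
  qed
qed

lemma rebase_ge_10: "10 \<le> a \<Longrightarrow> 10 \<le> b \<Longrightarrow> 10 \<le> rebase a b"
  using le_rebase[of 1 a 1 b] by simp

subsection \<open>Iterated rebasing\<close>

context
  fixes f g :: "nat \<Rightarrow> nat"
  assumes f: "\<And>m. 10 \<le> m \<Longrightarrow> 10 ^ f m \<le> m"
    and g: "\<And>m. 10 \<le> m \<Longrightarrow> m < 10 ^ g m"
begin

text \<open>In a right fold the inner result becomes the base of the next rebasing. The bound by 10
  is therefore carried through the induction, since \<open>rebase_less\<close> requires it of the
  base.\<close>

lemma foldr_rebase_bounds:
  assumes "\<forall>x\<in>set xs. 10 \<le> x" "10 \<le> b" "10 ^ p \<le> b" "b < 10 ^ q"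
  shows "10 \<le> foldr rebase xs b"
    and "10 ^ (prod_list (map f xs) * p) \<le> foldr rebase xs b"
    and "foldr rebase xs b < 10 ^ (prod_list (map g xs) * q)"
  using assms(1)
proof (induction xs)
  case (Cons x xs)
  {
    case 1 with Cons show ?case by (simp add: rebase_ge_10)
  next
    case 2
    with Cons f[of x] show ?case by (simp add: le_rebase mult.assoc)
  next
    case 3
    with Cons g[of x] show ?case by (simp add: rebase_less mult.assoc)
  }
qed (use assms in simp_all)

text \<open>Here the list elements are the bases and the accumulator is the digit string. Each step
  multiplies its exponents by \<open>f x\<close> and \<open>g x\<close>, hence the generalisation
  over \<open>a\<close>, \<open>p\<close> and \<open>q\<close>.\<close>

lemma foldl_rebase_bounds:
  assumes "\<forall>x\<in>set xs. 10 \<le> x" "10 \<le> a" "10 ^ p \<le> a" "a < 10 ^ q"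
  shows "10 ^ (p * prod_list (map f xs)) \<le> foldl rebase a xs"
    and "foldl rebase a xs < 10 ^ (q * prod_list (map g xs))"
  using assms
proof (induction xs arbitrary: a p q)
  case (Cons x xs)
  {
    case 1
    with Cons.IH(1)[of "rebase a x" "p * f x"] f[of x] rebase_less[of x a q "g x"] g[of x]
    show ?case by (simp add: le_rebase rebase_ge_10 mult.assoc)
  next
    case 2
    with Cons.IH(2)[of "rebase a x" "p * f x" "q * g x"] f[of x] g[of x]
    show ?case by (simp add: le_rebase rebase_less rebase_ge_10 mult.assoc)
  }
qed simp_all

lemma sequence_bounds:
  assumes "s \<in> {alpha, beta, gamma, delta}" "10 \<le> n"
  shows "10 ^ (\<Prod>m=10..n. f m) \<le> s n" "s n < 10 ^ (\<Prod>m=10..n. g m)"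
proof -
  have upt: "prod_list (map h [i..<j]) = (\<Prod>m=i..<j. h m)" for h :: "nat \<Rightarrow> nat" and i j
    by (simp add: prod.distinct_set_conv_list[symmetric])
  have rev: "prod_list (map h (rev xs)) = prod_list (map h xs)" for h :: "nat \<Rightarrow> nat" and xs
    by (simp add: rev_map[symmetric] prod_list.rev)
  \<comment> \<open>\<open>alpha\<close> and \<open>delta\<close> start from \<open>n\<close> and
    fold over 10 to \<open>n - 1\<close>, while \<open>beta\<close> and \<open>gamma\<close> start
    from 10 and fold over 11 to \<open>n\<close>; so the last or the first factor is split
    off.\<close>
  have last: "(\<Prod>m=10..n. h m) = (\<Prod>m=10..<n. h m) * h n" for h :: "nat \<Rightarrow> nat"
    using assms(2) by (simp add: prod.last_plus mult.commute)
  have first: "(\<Prod>m=10..n. h m) = h 10 * (\<Prod>m=11..<Suc n. h m)" for h :: "nat \<Rightarrow> nat"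
    using assms(2) by (simp add: prod.atLeast_Suc_atMost atLeastLessThanSuc_atLeastAtMost)
  note rules = foldr_rebase_bounds(2,3)[of "[10..<n]" n "f n" "g n"]
    foldl_rebase_bounds[of "[11..<Suc n]" 10 "f 10" "g 10"]
    foldr_rebase_bounds(2,3)[of "rev [11..<Suc n]" 10 "f 10" "g 10"]
    foldl_rebase_bounds[of "rev [10..<n]" n "f n" "g n"]
  have A: "10 ^ (\<Prod>m=10..n. f m) \<le> alpha n" "alpha n < 10 ^ (\<Prod>m=10..n. g m)"
    using rules(1,2) assms(2) f[of n] g[of n] by (simp_all add: alpha_def upt last)
  have B: "10 ^ (\<Prod>m=10..n. f m) \<le> beta n" "beta n < 10 ^ (\<Prod>m=10..n. g m)"
    using rules(3,4) f[of 10] g[of 10]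
    unfolding beta_def upt first by auto
  have C: "10 ^ (\<Prod>m=10..n. f m) \<le> gamma n" "gamma n < 10 ^ (\<Prod>m=10..n. g m)"
    using rules(5,6) f[of 10] g[of 10]
    unfolding gamma_def rev upt first by (auto simp: mult.commute)
  have D: "10 ^ (\<Prod>m=10..n. f m) \<le> delta n" "delta n < 10 ^ (\<Prod>m=10..n. g m)"
    using rules(7,8) assms(2) f[of n] g[of n]
    unfolding delta_def rev upt last by (auto simp: mult.commute)
  show "10 ^ (\<Prod>m=10..n. f m) \<le> s n" "s n < 10 ^ (\<Prod>m=10..n. g m)"
    using A B C D assms(1) by auto
qed

end

subsection \<open>Asymptotics\<close>

lemma log_prod_nat:
  assumes "\<And>x. x \<in> A \<Longrightarrow> 0 < (h x :: nat)"
  shows "log 10 (real (\<Prod>x\<in>A. h x)) = (\<Sum>x\<in>A. log 10 (real (h x)))"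
  using assms
\<comment> \<open>For infinite \<open>A\<close> the product defaults to 1 and the sum to 0, so the
  equation persists.\<close>
proof (induction A rule: infinite_finite_induct)
  case (insert x A)
  then have "0 < (\<Prod>x\<in>A. real (h x))" by (intro prod_pos) auto
  with insert show ?case by (simp add: log_mult)
qed simp_all

lemma loglog_sequence_bounds:
  assumes s: "s \<in> {alpha, beta, gamma, delta}" and n: "10 \<le> n"
  defines "k \<equiv> \<lambda>m::nat. nat \<lfloor>log 10 (real m)\<rfloor>"
  shows "(\<Sum>m=10..n. log 10 (real (k m))) \<le> log 10 (log 10 (real (s n)))"
    and "log 10 (log 10 (real (s n))) \<le> (\<Sum>m=10..n. log 10 (real (k m + 1)))"
proof -
  have k_pos: "0 < k m" if "10 \<le> m" for m
  proof -
    have "1 \<le> log 10 (real m)" using that by (simp add: le_log_iff)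
    then show ?thesis by (simp add: k_def)
  qed
  have lo: "10 ^ k m \<le> m" if "10 \<le> m" for m
  proof -
    have "real (k m) \<le> log 10 (real m)" using that by (simp add: k_def)
    then have "10 powr real (k m) \<le> real m" using that by (simp add: le_log_iff)
    then have "10 ^ k m \<le> real m" by (subst (asm) powr_realpow) auto
    then show ?thesis by (metis of_nat_le_iff of_nat_numeral of_nat_power)
  qed
  have hi: "m < 10 ^ (k m + 1)" if "10 \<le> m" for m
  proof -
    have "log 10 (real m) < real (k m + 1)" unfolding k_def by linarith
    then have "real m < 10 powr real (k m + 1)" using that by (subst (asm) log_less_iff) auto
    then have "real m < 10 ^ (k m + 1)" by (subst (asm) powr_realpow) auto
    then show ?thesis by (metis of_nat_less_iff of_nat_numeral of_nat_power)
  qed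
  define P where "P = (\<Prod>m=10..n. k m)"
  define Q where "Q = (\<Prod>m=10..n. k m + 1)"
  \<comment> \<open>Positivity allows the second logarithm to be taken monotonically in the lower
    bound.\<close>
  have "P > 0" unfolding P_def by (rule prod_pos) (simp add: k_pos)
  have "10 ^ P \<le> s n" "s n < 10 ^ Q"
    using sequence_bounds[of k "\<lambda>m. k m + 1", OF lo hi s n] by (simp_all add: P_def Q_def)
  moreover have "s n > 0" using \<open>10 ^ P \<le> s n\<close> by (metis gr0I le_zero_eq power_not_zero zero_neq_numeral)
  moreover have "10 powr real P = real (10 ^ P)" "10 powr real Q = real (10 ^ Q)"
    by (simp_all add: powr_realpow)
  ultimately have "real P \<le> log 10 (real (s n))" "log 10 (real (s n)) \<le> real Q"
    by (simp_all only: le_log_iff log_le_iff of_nat_le_iff of_nat_0_less_iff)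
  then have "log 10 (real P) \<le> log 10 (log 10 (real (s n)))"
      "log 10 (log 10 (real (s n))) \<le> log 10 (real Q)"
    using \<open>P > 0\<close> by (simp_all add: log_le_cancel_iff)
  moreover have "log 10 (real P) = (\<Sum>m=10..n. log 10 (real (k m)))"
    unfolding P_def by (rule log_prod_nat) (simp add: k_pos)
  moreover have "log 10 (real Q) = (\<Sum>m=10..n. log 10 (real (k m + 1)))"
    unfolding Q_def by (rule log_prod_nat) simp
  ultimately show "(\<Sum>m=10..n. log 10 (real (k m))) \<le> log 10 (log 10 (real (s n)))"
    and "log 10 (log 10 (real (s n))) \<le> (\<Sum>m=10..n. log 10 (real (k m + 1)))"
    by simp_all
qed

lemma sum_log_upper:
  assumes "10 \<le> n"
  shows "(\<Sum>m=10..n. log 10 (real (nat \<lfloor>log 10 (real m)\<rfloor> + 1)))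
    \<le> real n * log 10 (log 10 (real n) + 1)"
proof -
  have "log 10 (real (nat \<lfloor>log 10 (real m)\<rfloor> + 1)) \<le> log 10 (log 10 (real n) + 1)"
    if "m \<in> {10..n}" for m
  proof -
    have "0 \<le> log 10 (real m)" "log 10 (real m) \<le> log 10 (real n)" using that by auto
    then have "real (nat \<lfloor>log 10 (real m)\<rfloor> + 1) \<le> log 10 (real n) + 1" by simp linarith
    then show ?thesis by (subst log_le_cancel_iff) (use \<open>0 \<le> log 10 (real m)\<close> \<open>log 10 (real m) \<le> log 10 (real n)\<close> in linarith)+
  qed
  then have "(\<Sum>m=10..n. log 10 (real (nat \<lfloor>log 10 (real m)\<rfloor> + 1)))
      \<le> real (card {10..n}) * log 10 (log 10 (real n) + 1)"
    by (rule sum_bounded_above)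
  also have "\<dots> \<le> real n * log 10 (log 10 (real n) + 1)"
  proof (rule mult_right_mono)
    have "0 \<le> log 10 (real n)" using assms by simp
    then show "0 \<le> log 10 (log 10 (real n) + 1)" by simp
  qed auto
  finally show ?thesis .
qed

text \<open>Dropping all \<open>m\<close> below \<open>sqrt n\<close> loses only o(n) terms. For the
  others, \<open>log 10 m\<close> is at least half of \<open>log 10 n\<close>, and the floor costs
  at most 1.\<close>

lemma sum_log_lower:
  assumes "10000 \<le> n"
  shows "(real n - sqrt (real n)) * log 10 (log 10 (real n) / 2 - 1)
    \<le> (\<Sum>m=10..n. log 10 (real (nat \<lfloor>log 10 (real m)\<rfloor>)))"
proof -
  define r where "r = nat \<lceil>sqrt (real n)\<rceil>"
  define C where "C = log 10 (log 10 (real n) / 2 - 1)"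
  have "100 \<le> sqrt (real n)" using assms by (intro real_le_rsqrt) simp
  then have r: "sqrt (real n) \<le> real r" "real r < sqrt (real n) + 1" "100 \<le> r"
    unfolding r_def by linarith+
  \<comment> \<open>The threshold 10000 makes the argument of the logarithm in \<open>C\<close> at
    least 1, so that \<open>C \<ge> 0\<close>.\<close>
  have "4 \<le> log 10 (real n)" using assms by (simp add: le_log_iff)
  then have "0 \<le> C" by (simp add: C_def)
  have C_le: "C \<le> log 10 (real (nat \<lfloor>log 10 (real m)\<rfloor>))" if "m \<in> {r..n}" for m
  proof -
    have "log 10 (real n) / 2 = log 10 (sqrt (real n))"
      using assms by (simp add: log_def ln_sqrt)
    also have "\<dots> \<le> log 10 (real m)" using that r assms by (subst log_le_cancel_iff) auto
    finally have "log 10 (real n) / 2 - 1 \<le> real (nat \<lfloor>log 10 (real m)\<rfloor>)" by linarith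
    then show ?thesis using \<open>4 \<le> log 10 (real n)\<close> unfolding C_def by (subst log_le_cancel_iff) linarith+
  qed
  \<comment> \<open>The interval has \<open>n + 1 - r\<close> elements, and
    \<open>r < sqrt n + 1\<close>.\<close>
  have "(real n - sqrt (real n)) * C \<le> real (card {r..n}) * C"
    using r \<open>0 \<le> C\<close> by (intro mult_right_mono) auto
  also have "\<dots> \<le> (\<Sum>m=r..n. log 10 (real (nat \<lfloor>log 10 (real m)\<rfloor>)))"
    using C_le by (rule sum_bounded_below)
  also have "\<dots> \<le> (\<Sum>m=10..n. log 10 (real (nat \<lfloor>log 10 (real m)\<rfloor>)))"
  proof (rule sum_mono2)
    \<comment> \<open>The dropped terms are nonnegative because \<open>m \<ge> 10\<close> makes the
      floor at least 1.\<close>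
    show "0 \<le> log 10 (real (nat \<lfloor>log 10 (real m)\<rfloor>))" if "m \<in> {10..n} - {r..n}" for m
    proof -
      have "1 \<le> log 10 (real m)" using that by (simp add: le_log_iff)
      then have "1 \<le> real (nat \<lfloor>log 10 (real m)\<rfloor>)" by simp
      then show ?thesis by (subst zero_le_log_cancel_iff) linarith+
    qed
  qed (use r in auto)
  finally show ?thesis unfolding C_def .
qed

theorem theorem1:
  fixes s :: "nat \<Rightarrow> nat"
  assumes "s \<in> {alpha, beta, gamma, delta}"
  shows "(\<lambda>n. log 10 (log 10 (real (s n)))) \<sim>[at_top]
    (\<lambda>n. real n * log 10 (log 10 (real n)))"
proof (rule asymp_equiv_sandwich_real)
  \<comment> \<open>The factor 1/2 and the shift by 1 change the outer logarithm only by a bounded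
    amount, and \<open>sqrt n\<close> is o(n).\<close>
  show "(\<lambda>n::nat. (real n - sqrt (real n)) * log 10 (log 10 (real n) / 2 - 1)) \<sim>[at_top]
      (\<lambda>n. real n * log 10 (log 10 (real n)))"
    by real_asymp
  show "(\<lambda>n::nat. real n * log 10 (log 10 (real n) + 1)) \<sim>[at_top]
      (\<lambda>n. real n * log 10 (log 10 (real n)))"
    by real_asymp
  show "\<forall>\<^sub>F n in at_top. log 10 (log 10 (real (s n)))
      \<in> {(real n - sqrt (real n)) * log 10 (log 10 (real n) / 2 - 1)..
          real n * log 10 (log 10 (real n) + 1)}"
    using eventually_ge_at_top[of 10000]
  proof eventually_elim
    case (elim n)
    then show ?case
      using loglog_sequence_bounds[OF assms, of n] sum_log_lower[of n] sum_log_upper[of n]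
      by auto
  qed
qed

end
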